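(* Let $(g_n)_{n\ge1}$ be a sequence of real numbers with $\sum_{n=1}^\infty g_n^2<\infty$, and put $\overline{g}_n:=\frac1n(g_1+\dots+g_n)$. Let $a,a'$ be real numbers with $a>a'>-2\inf_{n\ge1}\overline{g}_n$. Then the probability measures $\pi_a$ and $\pi_{a'}$ on $\mathbb{R}_+^\infty$ are mutually singular, where for a real number $b>-2\inf_{n\ge1}\overline{g}_n$, $$\pi_b:=\bigotimes_{n=1}^\infty\mathrm{Exp}\big(2(g_1+\dots+g_n)+nb\big).$$
   Context: $\mathbb{R}_+^\infty$ is the space of sequences $(z_1,z_2,\dots)$ with $z_i\in[0,\infty)$, with the product $\sigma$-algebra. $\mathrm{Exp}(\lambda)$ is the exponential distribution with density $\lambda e^{-\lambda x}$, $x>0$ (mean $\lambda^{-1}$); $\bigotimes$ denotes product measure. *)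

theory Defs
  imports "HOL-Probability.Probability"
begin

text \<open>The exponential distribution with rate \<open>l\<close> (mean \<open>1/l\<close>), living on the half-line
  \<open>[0,\<infinity>)\<close> rather than on all reals, so that products of it live on sequences of
  nonnegative reals. It is meaningful only for \<open>l > 0\<close>.\<close>

definition exp_distr :: "real \<Rightarrow> real measure" where
  "exp_distr l = restrict_space (density lborel (exponential_density l)) {0..}"

lemma space_exp_distr [simp]: "space (exp_distr l) = {0..}"
  by (simp add: exp_distr_def space_restrict_space)

lemma sets_exp_distr [simp]: "sets (exp_distr l) = sets (restrict_space borel {0..})"
  unfolding exp_distr_def by (rule sets_restrict_space_cong) simp

lemma prob_space_exp_distr:
  assumes "0 < l"
  shows "prob_space (exp_distr l)"
proof -
  have d: "(\<lambda>x. ennreal (exponential_density l x)) \<in> borel_measurable lborel"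
    by (simp add: exponential_density_def)
  interpret P: prob_space "density lborel (exponential_density l)"
    using assms by (rule prob_space_exponential_density)
  have "emeasure (density lborel (exponential_density l)) {0..} =
      emeasure (density lborel (exponential_density l)) UNIV"
    using d by (auto simp: emeasure_density exponential_density_def indicator_def
        intro!: nn_integral_cong)
  also have "\<dots> = 1"
    using P.emeasure_space_1 by simp
  finally show ?thesis
    by (intro prob_spaceI) (simp add: exp_distr_def emeasure_restrict_space space_restrict_space)
qed

text \<open>A sequence \<open>g\<^sub>1, g\<^sub>2, \<dots>\<close> is a function on \<^typ>\<open>nat\<close> of which only the values at indices
  \<open>n \<ge> 1\<close> are used.\<close>

definition gbar :: "(nat \<Rightarrow> real) \<Rightarrow> nat \<Rightarrow> real" where
  "gbar g n = (1 / real n) * (\<Sum>i=1..n. g i)"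

definition pi_measure :: "(nat \<Rightarrow> real) \<Rightarrow> real \<Rightarrow> (nat \<Rightarrow> real) measure" where
  "pi_measure g b = (\<Pi>\<^sub>M n\<in>{1..}. exp_distr (2 * (\<Sum>i=1..n. g i) + real n * b))"

definition mutually_singular :: "'a measure \<Rightarrow> 'a measure \<Rightarrow> bool" where
  "mutually_singular M N \<longleftrightarrow>
    sets M = sets N \<and> (\<exists>A\<in>sets M. emeasure M A = 0 \<and> emeasure N (space N - A) = 0)"

text \<open>On the reals, \<open>INF\<close> is the genuine infimum only for a family that is bounded below; square
  summability of \<open>g\<close> guarantees this for the averages.\<close>

lemma bdd_below_gbar:
  assumes "summable (\<lambda>n. (g (Suc n))\<^sup>2)"
  shows "bdd_below (gbar g ` {1..})"
proof -
  have "(\<lambda>n. (g (Suc n))\<^sup>2) \<longlonglongrightarrow> 0"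
    using assms by (rule summable_LIMSEQ_zero)
  then have "Bseq (\<lambda>n. (g (Suc n))\<^sup>2)"
    by (intro convergent_imp_Bseq convergentI)
  then obtain K where K: "K > 0" "\<And>n. norm ((g (Suc n))\<^sup>2) \<le> K"
    by (auto simp: Bseq_def)
  have g: "- sqrt K \<le> g i" if "i \<ge> 1" for i
  proof -
    obtain n where "i = Suc n" using \<open>i \<ge> 1\<close> by (cases i) auto
    then have "\<bar>g i\<bar> \<le> sqrt K"
      using K(2)[of n] real_sqrt_le_mono[of "(g i)\<^sup>2" K] by simp
    then show ?thesis by simp
  qed
  have "- sqrt K \<le> gbar g n" if "n \<ge> 1" for n
  proof -
    have "(\<Sum>i=1..n. - sqrt K) \<le> (\<Sum>i=1..n. g i)"
      by (rule sum_mono) (use g in auto)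
    then show ?thesis
      using that by (simp add: gbar_def field_simps)
  qed
  then show ?thesis
    by (auto intro!: bdd_belowI)
qed

lemma prob_space_pi_measure:
  assumes "summable (\<lambda>n. (g (Suc n))\<^sup>2)"
    and "b > - 2 * (INF n\<in>{1..}. gbar g n)"
  shows "prob_space (pi_measure g b)"
proof -
  have "2 * (\<Sum>i=1..n. g i) + real n * b > 0" if "n \<ge> 1" for n
  proof -
    have "(INF n\<in>{1..}. gbar g n) \<le> gbar g n"
      using bdd_below_gbar[OF assms(1)] that by (intro cINF_lower) auto
    then have "2 * gbar g n + b > 0"
      using assms(2) by linarith
    then have "real n * (2 * gbar g n + b) > 0"
      using that by simp
    moreover have "real n * (2 * gbar g n + b) = 2 * (\<Sum>i=1..n. g i) + real n * b"
      using that by (simp add: gbar_def distrib_left)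
    ultimately show ?thesis by simp
  qed
  then show ?thesis
    unfolding pi_measure_def by (auto intro!: prob_space_PiM prob_space_exp_distr)
qed

end

theory Submission
  imports Defs
begin

text \<open>The rates of the \<open>n\<close>-th factors have ratio \<open>(2 gbar g n + a) / (2 gbar g n + a')\<close>, which
  stays away from \<open>1\<close> because the averages are bounded. Hence the Hellinger affinities of the
  factors are at most some \<open>r < 1\<close>, and those of the first \<open>n\<close> coordinates at most \<open>r ^ n\<close>. By
  Markov's inequality, the sets where the square root of the likelihood ratio of \<open>n\<close> coordinates
  exceeds \<open>1\<close> have measure at most \<open>r ^ n\<close> for one product and at least \<open>1 - r ^ n\<close> for the
  other, and the Borel--Cantelli lemma makes their limit superior a separating set.\<close>

text \<open>The integrand depends only on the coordinates in \<open>J\<close>, so the integral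
  reduces to the finite product over \<open>J\<close>, where it factorises.\<close>

lemma nn_integral_PiM_prod:
  fixes f :: "'i \<Rightarrow> 'a \<Rightarrow> ennreal"
  assumes M: "\<And>i. i \<in> I \<Longrightarrow> prob_space (M i)"
    and J: "finite J" "J \<subseteq> I"
    and f: "\<And>i. i \<in> J \<Longrightarrow> f i \<in> borel_measurable (M i)"
  shows "(\<integral>\<^sup>+x. (\<Prod>i\<in>J. f i (x i)) \<partial>PiM I M) = (\<Prod>i\<in>J. \<integral>\<^sup>+x. f i x \<partial>M i)"
proof -
  \<comment> \<open>The locale \<open>product_prob_space\<close> asks for a probability space at
    every index, so a one-point space is put outside \<open>I\<close>; this leaves
    \<open>PiM I M\<close> unchanged.\<close>
  define M' where "M' i = (if i \<in> I then M i else count_space {undefined})" for i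
  interpret M': prob_space "M' i" for i
    using M by (cases "i \<in> I") (auto simp: M'_def intro!: prob_spaceI)
  interpret product_prob_space M' I
    by unfold_locales
  have f': "f i \<in> borel_measurable (M' i)" if "i \<in> J" for i
    using f[OF that] J that by (auto simp: M'_def)
  have eq: "PiM I M = PiM I M'"
    by (intro PiM_cong) (auto simp: M'_def)
  have "(\<integral>\<^sup>+x. (\<Prod>i\<in>J. f i (x i)) \<partial>PiM I M')
      = (\<integral>\<^sup>+x. (\<Prod>i\<in>J. f i (restrict x J i)) \<partial>PiM I M')"
    by (intro nn_integral_cong prod.cong) auto
  also have "\<dots> = (\<integral>\<^sup>+x. (\<Prod>i\<in>J. f i (x i)) \<partial>distr (PiM I M') (PiM J M') (\<lambda>x. restrict x J))"
    using J f' by (intro nn_integral_distr[symmetric] measurable_restrict_subset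
        borel_measurable_prod_ennreal measurable_compose[OF measurable_component_singleton]) auto
  also have "\<dots> = (\<integral>\<^sup>+x. (\<Prod>i\<in>J. f i (x i)) \<partial>PiM J M')"
    using J by (simp add: distr_PiM_restrict_finite)
  also have "\<dots> = (\<Prod>i\<in>J. \<integral>\<^sup>+x. f i x \<partial>M' i)"
    using J f' by (intro product_nn_integral_prod) auto
  also have "\<dots> = (\<Prod>i\<in>J. \<integral>\<^sup>+x. f i x \<partial>M i)"
    using J by (intro prod.cong) (auto simp: M'_def)
  finally show ?thesis
    by (simp only: eq)
qed

text \<open>Markov's inequality at level 1: the indicator of the event lies below the positive
  product, whose integral factorises into terms at most \<open>r\<close>.\<close>

lemma emeasure_prod_ge_1_le:
  fixes h :: "'i \<Rightarrow> 'a \<Rightarrow> real"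
  assumes M: "\<And>i. i \<in> I \<Longrightarrow> prob_space (M i)"
    and J: "finite J" "J \<subseteq> I"
    and h: "\<And>i. i \<in> J \<Longrightarrow> h i \<in> borel_measurable (M i)"
    and pos: "\<And>i x. i \<in> J \<Longrightarrow> 0 < h i x"
    and le: "\<And>i. i \<in> J \<Longrightarrow> (\<integral>\<^sup>+x. h i x \<partial>M i) \<le> ennreal r"
    and "0 \<le> r"
  shows "emeasure (PiM I M) {x \<in> space (PiM I M). 1 \<le> (\<Prod>i\<in>J. h i (x i))} \<le> ennreal (r ^ card J)"
proof -
  let ?P = "PiM I M"
  have [measurable]: "(\<lambda>x. h i (x i)) \<in> borel_measurable ?P" if "i \<in> J" for i
    using that J h[OF that] by (auto intro!: measurable_compose[OF measurable_component_singleton])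
  have "emeasure ?P {x \<in> space ?P. 1 \<le> (\<Prod>i\<in>J. h i (x i))}
      = (\<integral>\<^sup>+x. indicator {x \<in> space ?P. 1 \<le> (\<Prod>i\<in>J. h i (x i))} x \<partial>?P)"
    by (intro nn_integral_indicator[symmetric]) measurable
  also have "\<dots> \<le> (\<integral>\<^sup>+x. (\<Prod>i\<in>J. ennreal (h i (x i))) \<partial>?P)"
    using pos by (intro nn_integral_mono)
      (auto simp: indicator_def prod_ennreal less_imp_le simp flip: ennreal_1 intro!: ennreal_leI)
  also have "\<dots> = (\<Prod>i\<in>J. \<integral>\<^sup>+x. h i x \<partial>M i)"
    using M J h by (intro nn_integral_PiM_prod) auto
  also have "\<dots> \<le> (\<Prod>i\<in>J. ennreal r)"
    using le by (intro prod_mono_ennreal) auto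
  also have "\<dots> = ennreal (r ^ card J)"
    using \<open>0 \<le> r\<close> by (simp add: ennreal_power)
  finally show ?thesis .
qed

text \<open>By Borel--Cantelli, \<open>M\<close>-almost every point lies in only finitely many
  \<open>B n\<close>, and \<open>N\<close>-almost every point lies in all but finitely many. The
  limit superior of the \<open>B n\<close> therefore separates the two measures.\<close>

lemma mutually_singular_if_summable:
  assumes "prob_space M" "prob_space N" and sets: "sets M = sets N"
    and B: "\<And>n. B n \<in> sets M"
    and M: "\<And>n. emeasure M (B n) \<le> ennreal (e n)"
    and N: "\<And>n. emeasure N (space N - B n) \<le> ennreal (e n)"
    and "summable e" and e: "\<And>n. 0 \<le> e n"
  shows "mutually_singular M N"
proof -
  interpret M: prob_space M by fact
  interpret N: prob_space N by fact
  have space: "space M = space N"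
    using sets by (rule sets_eq_imp_space_eq)
  have [measurable]: "B n \<in> sets M" "B n \<in> sets N" for n
    using B sets by auto
  have "summable (\<lambda>n. measure M (B n))"
  proof (rule summable_comparison_test'[OF \<open>summable e\<close>])
    show "norm (measure M (B n)) \<le> e n" for n
      using M[of n] e[of n] by (simp add: M.emeasure_eq_measure)
  qed
  then have AE_M: "AE x in M. \<forall>\<^sub>F n in sequentially. x \<in> space M - B n"
    by (intro borel_cantelli_AE1) (auto simp: less_top[symmetric])
  have "summable (\<lambda>n. measure N (space N - B n))"
  proof (rule summable_comparison_test'[OF \<open>summable e\<close>])
    show "norm (measure N (space N - B n)) \<le> e n" for n
      using N[of n] e[of n] by (simp add: N.emeasure_eq_measure)
  qed
  then have AE_N: "AE x in N. \<forall>\<^sub>F n in sequentially. x \<in> space N - (space N - B n)"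
    by (intro borel_cantelli_AE1) (auto simp: less_top[symmetric])
  define A where "A = {x \<in> space M. \<exists>\<^sub>F n in sequentially. x \<in> B n}"
  have A: "A \<in> sets M"
    unfolding A_def frequently_sequentially by measurable
  have "AE x in M. x \<notin> A"
    using AE_M by eventually_elim (auto simp: A_def not_frequently elim: eventually_mono)
  then have "emeasure M A = 0"
    using A by (simp add: AE_iff_measurable[OF A] A_def)
  moreover have "AE x in N. x \<notin> space N - A"
    using AE_N
  proof eventually_elim
    case (elim x)
    then have "\<forall>\<^sub>F n in sequentially. x \<in> B n"
      by (rule eventually_mono) auto
    then have "\<exists>\<^sub>F n in sequentially. x \<in> B n"
      by (intro eventually_frequently) auto
    then show ?case
      by (auto simp: A_def space)
  qed
  then have "emeasure N (space N - A) = 0"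
    using A sets by (subst (asm) AE_iff_measurable[of "space N - A"]) (auto simp: A_def)
  ultimately show ?thesis
    using A sets by (auto simp: mutually_singular_def)
qed

text \<open>The model for \<open>h i\<close> is the square root of the density of \<open>N i\<close>
  with respect to \<open>M i\<close>: then both integrals equal the Hellinger affinity of the two
  factors. The conditions on \<open>h\<close> are symmetric under exchanging \<open>M\<close> with
  \<open>N\<close> and \<open>h\<close> with its reciprocal, so one Markov estimate serves both
  sides.\<close>

lemma mutually_singular_PiM:
  fixes h :: "'i \<Rightarrow> 'a \<Rightarrow> real"
  assumes "infinite I"
    and M: "\<And>i. i \<in> I \<Longrightarrow> prob_space (M i)"
    and N: "\<And>i. i \<in> I \<Longrightarrow> prob_space (N i)"
    and sets: "\<And>i. i \<in> I \<Longrightarrow> sets (M i) = sets (N i)"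
    and h: "\<And>i. i \<in> I \<Longrightarrow> h i \<in> borel_measurable (M i)"
    and pos: "\<And>i x. i \<in> I \<Longrightarrow> 0 < h i x"
    and hM: "\<And>i. i \<in> I \<Longrightarrow> (\<integral>\<^sup>+x. h i x \<partial>M i) \<le> ennreal r"
    and hN: "\<And>i. i \<in> I \<Longrightarrow> (\<integral>\<^sup>+x. inverse (h i x) \<partial>N i) \<le> ennreal r"
    and r: "0 \<le> r" "r < 1"
  shows "mutually_singular (PiM I M) (PiM I N)"
proof -
  \<comment> \<open>A sequence of distinct indices yields finite sets \<open>J n\<close> with
    exactly \<open>n\<close> elements, so that the bounds \<open>r ^ n\<close> are summable.\<close>
  obtain f :: "nat \<Rightarrow> 'i" where f: "inj f" "range f \<subseteq> I"
    using infinite_countable_subset[OF \<open>infinite I\<close>] by auto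
  define J where "J n = f ` {..<n}" for n
  have J: "finite (J n)" "J n \<subseteq> I" "card (J n) = n" for n
    using f by (auto simp: J_def card_image inj_on_subset[OF f(1)])
  have h': "h i \<in> borel_measurable (N i)" if "i \<in> I" for i
    using h[OF that] sets[OF that] by (simp cong: measurable_cong_sets)
  have sets': "sets (PiM I M) = sets (PiM I N)"
    using sets by (intro sets_PiM_cong) auto
  then have space: "space (PiM I M) = space (PiM I N)"
    by (rule sets_eq_imp_space_eq)
  \<comment> \<open>Off \<open>B n\<close> the product is below 1, so its reciprocal exceeds 1;
    hence \<open>C n\<close> covers the complement of \<open>B n\<close> and can be bounded by the
    same estimate under \<open>N\<close>.\<close>
  define B where "B n = {x \<in> space (PiM I M). 1 \<le> (\<Prod>i\<in>J n. h i (x i))}" for n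
  define C where "C n = {x \<in> space (PiM I N). 1 \<le> (\<Prod>i\<in>J n. inverse (h i (x i)))}" for n
  have [measurable]: "(\<lambda>x. h i (x i)) \<in> borel_measurable (PiM I M)"
      "(\<lambda>x. h i (x i)) \<in> borel_measurable (PiM I N)" if "i \<in> J n" for i n
    using that J(2)[of n] h h'
    by (auto intro!: measurable_compose[OF measurable_component_singleton])
  have "space (PiM I N) - B n \<subseteq> C n" for n
  proof
    fix x assume "x \<in> space (PiM I N) - B n"
    then have x: "x \<in> space (PiM I N)" "(\<Prod>i\<in>J n. h i (x i)) \<le> 1"
      by (auto simp: B_def space)
    have "0 < (\<Prod>i\<in>J n. h i (x i))"
      using pos J(2)[of n] by (intro prod_pos) auto
    with x show "x \<in> C n"
      by (simp add: C_def one_le_inverse prod_inversef[unfolded o_def])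
  qed
  moreover have "C n \<in> sets (PiM I N)" for n
    unfolding C_def by measurable
  moreover have "emeasure (PiM I N) (C n) \<le> ennreal (r ^ n)" for n
    using emeasure_prod_ge_1_le[of I N "J n" "\<lambda>i x. inverse (h i x)" r] J[of n] N h' pos hN r
    by (auto simp: C_def subset_iff)
  ultimately have "emeasure (PiM I N) (space (PiM I N) - B n) \<le> ennreal (r ^ n)" for n
    by (meson emeasure_mono order_trans)
  moreover have "emeasure (PiM I M) (B n) \<le> ennreal (r ^ n)" for n
    using emeasure_prod_ge_1_le[of I M "J n" h r] J[of n] M h pos hM r
    by (auto simp: B_def subset_iff)
  moreover have "B n \<in> sets (PiM I M)" for n
    unfolding B_def by measurable
  ultimately show ?thesis
    using r M N sets'
    by (intro mutually_singular_if_summable[where B = B and e = "\<lambda>n. r ^ n"] prob_space_PiM)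
      (auto intro!: summable_geometric)
qed

text \<open>The integrand is the square root of the likelihood ratio of \<open>exp_distr k\<close> with respect to
  \<open>exp_distr l\<close>. Its reciprocal has the same form with \<open>k\<close> and \<open>l\<close> exchanged.\<close>

lemma hellinger_affinity_exp_distr:
  assumes "0 < k" "0 < l"
  shows "(\<integral>\<^sup>+x. ennreal (sqrt (k / l) * exp ((l - k) * x / 2)) \<partial>exp_distr l)
    = ennreal (2 * sqrt (k * l) / (k + l))"
proof -
  \<comment> \<open>The geometric mean of the two exponential densities is \<open>?c\<close> times
    the exponential density whose rate is the arithmetic mean \<open>?m\<close>. The constant is the
    geometric mean of the rates divided by their arithmetic mean.\<close>
  let ?m = "(k + l) / 2" and ?c = "2 * sqrt (k * l) / (k + l)"
  let ?h = "\<lambda>x. sqrt (k / l) * exp ((l - k) * x / 2)"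
  have m: "0 < ?m" using assms by simp
  interpret m: prob_space "density lborel (exponential_density ?m)"
    using m by (rule prob_space_exponential_density)
  have sq: "sqrt (k / l) * l = sqrt (k * l)"
    using assms by (simp add: real_sqrt_divide real_sqrt_mult field_simps)
  have pt: "exponential_density l x * ?h x = ?c * exponential_density ?m x" for x
  proof (cases "x < 0")
    case False
    have "exponential_density l x * ?h x
        = (sqrt (k / l) * l) * (exp (- x * l) * exp ((l - k) * x / 2))"
      using False by (simp add: exponential_density_def)
    also have "exp (- x * l) * exp ((l - k) * x / 2) = exp (- x * ?m)"
      by (simp add: exp_add[symmetric] field_simps)
    finally show ?thesis
      using False assms by (simp add: exponential_density_def sq)
  qed (simp add: exponential_density_def)
  have ind: "ennreal (exponential_density l x) * (ennreal (?h x) * indicator {0..} x)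
      = ennreal ?c * ennreal (exponential_density ?m x)" for x
  proof -
    have "ennreal (exponential_density l x) * (ennreal (?h x) * indicator {0..} x)
        = ennreal (exponential_density l x) * ennreal (?h x)"
      by (auto simp: indicator_def exponential_density_def)
    also have "\<dots> = ennreal (exponential_density l x * ?h x)"
      using assms by (intro ennreal_mult[symmetric] exponential_density_nonneg) auto
    also have "\<dots> = ennreal ?c * ennreal (exponential_density ?m x)"
      unfolding pt using assms m by (intro ennreal_mult exponential_density_nonneg) auto
    finally show ?thesis .
  qed
  have "(\<integral>\<^sup>+x. ennreal (?h x) \<partial>exp_distr l)
      = (\<integral>\<^sup>+x. ennreal (?h x) * indicator {0..} x \<partial>density lborel (exponential_density l))"
    unfolding exp_distr_def by (intro nn_integral_restrict_space) auto
  also have "\<dots> = (\<integral>\<^sup>+x. ennreal ?c * ennreal (exponential_density ?m x) \<partial>lborel)"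
    by (subst nn_integral_density) (simp_all only: ind, auto)
  also have "\<dots> = ennreal ?c * (\<integral>\<^sup>+x. ennreal (exponential_density ?m x) \<partial>lborel)"
    by (intro nn_integral_cmult) auto
  also have "(\<integral>\<^sup>+x. ennreal (exponential_density ?m x) \<partial>lborel) = 1"
    using m.emeasure_space_1 by (simp add: emeasure_density)
  finally show ?thesis by simp
qed

text \<open>Replacing \<open>g\<close> by its negative turns the lower bound for averages into an
  upper one.\<close>

lemma bdd_above_gbar:
  assumes "summable (\<lambda>n. (g (Suc n))\<^sup>2)"
  shows "bdd_above (gbar g ` {1..})"
proof -
  have "gbar (\<lambda>n. - g n) = (\<lambda>n. - gbar g n)"
    by (simp add: gbar_def fun_eq_iff sum_negf)
  then have "bdd_below ((\<lambda>n. - gbar g n) ` {1..})"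
    using bdd_below_gbar[of "\<lambda>n. - g n"] assms by simp
  then obtain m where "\<And>n. n \<ge> 1 \<Longrightarrow> m \<le> - gbar g n"
    unfolding bdd_below_def by force
  then show ?thesis
    by (intro bdd_aboveI[of _ "- m"]) force
qed

theorem propositionA2:
  fixes g :: "nat \<Rightarrow> real" and a a' :: real
  assumes "summable (\<lambda>n. (g (Suc n))\<^sup>2)"
    and "a > a'"
    and "a' > - 2 * (INF n\<in>{1..}. gbar g n)"
  shows "mutually_singular (pi_measure g a) (pi_measure g a')"
proof -
  obtain K where K: "\<And>n. n \<ge> 1 \<Longrightarrow> gbar g n \<le> K"
    using bdd_above_gbar[OF assms(1)] unfolding bdd_above_def by force
  have low: "0 < 2 * gbar g n + a'" if "n \<ge> 1" for n
  proof -
    have "(INF n\<in>{1..}. gbar g n) \<le> gbar g n"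
      using bdd_below_gbar[OF assms(1)] that by (intro cINF_lower) auto
    then show ?thesis
      using assms(3) by linarith
  qed
  \<comment> \<open>The rate of the \<open>n\<close>-th factor. By \<open>l_eq\<close> the rates for
    \<open>a\<close> and \<open>a'\<close> share the factor \<open>real n\<close>, which cancels in
    the affinity.\<close>
  define l where "l b n = 2 * (\<Sum>i=1..n. g i) + real n * b" for b n
  have l_eq: "l b n = real n * (2 * gbar g n + b)" if "n \<ge> 1" for b n
    using that by (simp add: l_def gbar_def distrib_left)
  have l_pos: "0 < l a n" "0 < l a' n" if "n \<ge> 1" for n
    using low[OF that] \<open>a > a'\<close> that by (auto simp: l_eq)
  \<comment> \<open>\<open>D\<close> bounds the sum of \<open>2 * gbar g n + a\<close> and
    \<open>2 * gbar g n + a'\<close> for all \<open>n \<ge> 1\<close>, so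
    \<open>(a - a') / D\<close> is a uniform lower bound for their relative difference.\<close>
  define D where "D = 4 * K + a + a'"
  define r where "r = sqrt (1 - ((a - a') / D)\<^sup>2)"
  \<comment> \<open>Here \<open>D - (a - a') = 2 * (2 * K + a')\<close>, which is positive because
    \<open>K\<close> bounds \<open>gbar g 1\<close> from above.\<close>
  have D: "0 < a - a'" "a - a' < D"
    using low[of 1] K[of 1] \<open>a > a'\<close> by (auto simp: D_def)
  then have "((a - a') / D)\<^sup>2 \<le> 1" "0 < ((a - a') / D)\<^sup>2"
    by (auto simp: power_le_one)
  then have r: "0 \<le> r" "r < 1"
    by (auto simp: r_def real_less_lsqrt)
  have le_r: "2 * sqrt (l a' n * l a n) / (l a' n + l a n) \<le> r" if n: "n \<ge> 1" for n
  proof -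
    define u v where "u = 2 * gbar g n + a'" and "v = 2 * gbar g n + a"
    have uv: "0 < u" "u < v" "u + v \<le> D" "v - u = a - a'"
      using low[OF n] K[OF n] \<open>a > a'\<close> by (auto simp: u_def v_def D_def)
    have "2 * sqrt (l a' n * l a n) / (l a' n + l a n) = 2 * sqrt (u * v) / (u + v)"
    proof -
      have "sqrt (l a' n * l a n) = sqrt ((real n)\<^sup>2 * (u * v))"
        using n by (simp add: l_eq u_def v_def power2_eq_square mult_ac)
      also have "\<dots> = real n * sqrt (u * v)"
        by (simp add: real_sqrt_mult)
      moreover have "l a' n + l a n = real n * (u + v)"
        using n by (simp add: l_eq u_def v_def distrib_left)
      ultimately show ?thesis
        using n by simp
    qed
    also have "\<dots> \<le> r"
      unfolding r_def
    proof (rule real_le_rsqrt)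
      \<comment> \<open>The identity \<open>4 * (u * v) = (u + v)\<^sup>2 - (v - u)\<^sup>2\<close>
        expresses the affinity through the relative difference.\<close>
      have "(2 * sqrt (u * v) / (u + v))\<^sup>2 = 1 - ((v - u) / (u + v))\<^sup>2"
      proof -
        have "(2 * sqrt (u * v) / (u + v))\<^sup>2 = 4 * (u * v) / (u + v)\<^sup>2"
          using uv by (simp add: power_divide power_mult_distrib)
        also have "\<dots> = ((u + v)\<^sup>2 - (v - u)\<^sup>2) / (u + v)\<^sup>2"
          by (simp add: power2_eq_square algebra_simps)
        also have "\<dots> = 1 - ((v - u) / (u + v))\<^sup>2"
          using uv by (simp add: diff_divide_distrib[of "_\<^sup>2"] power_divide)
        finally show ?thesis .
      qed
      also have "\<dots> \<le> 1 - ((a - a') / D)\<^sup>2"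
        using uv D by (intro diff_left_mono power_mono) (auto intro!: divide_left_mono)
      finally show "(2 * sqrt (u * v) / (u + v))\<^sup>2 \<le> 1 - ((a - a') / D)\<^sup>2" .
    qed
    finally show ?thesis .
  qed
  define h where "h n x = sqrt (l a' n / l a n) * exp ((l a n - l a' n) * x / 2)" for n and x :: real
  have inv_h: "inverse (h n x) = sqrt (l a n / l a' n) * exp ((l a' n - l a n) * x / 2)" for n x
  proof -
    have "(l a' n - l a n) * x / 2 = - ((l a n - l a' n) * x / 2)"
      by (simp add: field_simps)
    then show ?thesis
      by (simp only: h_def exp_minus inverse_mult_distrib real_sqrt_inverse[symmetric]
          inverse_divide)
  qed
  show ?thesis
    unfolding pi_measure_def l_def[symmetric]
  proof (rule mutually_singular_PiM[where h = h and r = r])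
    fix n :: nat assume "n \<in> {1..}"
    then have n: "n \<ge> 1" by simp
    note pos = l_pos[OF n]
    show "prob_space (exp_distr (l a n))" "prob_space (exp_distr (l a' n))"
      using pos by (auto intro: prob_space_exp_distr)
    show "h n \<in> borel_measurable (exp_distr (l a n))"
      unfolding exp_distr_def h_def by (intro measurable_restrict_space1) measurable
    show "0 < h n x" for x
      using pos by (simp add: h_def)
    show "(\<integral>\<^sup>+x. ennreal (h n x) \<partial>exp_distr (l a n)) \<le> ennreal r"
      using hellinger_affinity_exp_distr[of "l a' n" "l a n"] pos le_r[OF n]
      by (simp add: h_def ennreal_leI)
    \<comment> \<open>The affinity is symmetric in the two rates, so \<open>le_r\<close> applies
      again.\<close>
    show "(\<integral>\<^sup>+x. ennreal (inverse (h n x)) \<partial>exp_distr (l a' n)) \<le> ennreal r"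
      using hellinger_affinity_exp_distr[of "l a n" "l a' n"] pos le_r[OF n]
      by (simp add: inv_h ennreal_leI mult.commute add.commute)
  qed (use r in \<open>auto simp: infinite_Ici\<close>)
qed

end
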